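(* Let $\mathbb{F}$ be a field of characteristic zero, $\mathsf{G}$ a (finite) cyclic group of odd order with neutral element $e$, and $\mathfrak{A}=\bigoplus_{\xi\in\mathsf{G}}\mathfrak{A}_\xi$ an associative $\mathbb{F}$-algebra with a $\mathsf{G}$-grading. If $\mathfrak{A}_e$ is central in $\mathfrak{A}$, then the commutator ideal of $\mathfrak{A}$ is nilpotent. Consequently, $\mathfrak{A}^{(-)}$ is a solvable Lie algebra. In addition, there is some $n\in\mathbb{N}$ such that $[x_1,x_2][x_3,x_4]\cdots[x_{2n-1},x_{2n}]\equiv0$ in $\mathfrak{A}$, that is, $[a_1,a_2][a_3,a_4]\cdots[a_{2n-1},a_{2n}]=0$ for all $a_1,\dots,a_{2n}\in\mathfrak{A}$.
   Context: Algebras are associative, not necessarily unital and not necessarily finitely generated. A $\mathsf{G}$-grading satisfies $\mathfrak{A}_\xi\mathfrak{A}_\zeta\subseteq\mathfrak{A}_{\xi\zeta}$. "$\mathfrak{A}_e$ is central" means $\mathfrak{A}_e$ is contained in the center of $\mathfrak{A}$. $[a,b]=ab-ba$, and $\mathfrak{A}^{(-)}$ denotes the Lie algebra $(\mathfrak{A},[\ ,\ ])$. The commutator ideal of $\mathfrak{A}$ is the two-sided ideal generated by all $[a,b]$, $a,b\in\mathfrak{A}$; an ideal $I$ is nilpotent if $I^k=\{0\}$ for some $k$. A Lie algebra is solvable if its derived series reaches $\{0\}$. *)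

theory Defs
  imports Complex_Main "HOL-Algebra.Elementary_Groups"
begin

text \<open>The class \<^class>\<open>ring\<close> has associative multiplication but no unit, so the
  algebras below are associative and not necessarily unital.\<close>

locale assoc_algebra = vector_space scale
  for scale :: "'f::field \<Rightarrow> 'a::ring \<Rightarrow> 'a" (infixr \<open>*s\<close> 75) +
  assumes scale_mult_left: "(c *s x) * y = c *s (x * y)"
    and scale_mult_right: "x * (c *s y) = c *s (x * y)"

definition algebra_center :: "'a::ring set" where
  "algebra_center = {z. \<forall>x. z * x = x * z}"

definition commutator :: "'a::ring \<Rightarrow> 'a \<Rightarrow> 'a" where
  "commutator a b = a * b - b * a"

text \<open>The product \<open>x 1 * x 2 * \<dots> * x n\<close> in this order, for \<open>n \<ge> 1\<close>. There is
  no empty product without a unit; the value at \<open>n = 0\<close> has no meaning.\<close>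

definition ordered_prod :: "(nat \<Rightarrow> 'a::ring) \<Rightarrow> nat \<Rightarrow> 'a" where
  "ordered_prod x n = foldl (\<lambda>p i. p * x i) (x 1) [2..<Suc n]"

context assoc_algebra
begin

definition two_sided_ideal :: "'a set \<Rightarrow> bool" where
  "two_sided_ideal I \<longleftrightarrow> subspace I \<and> (\<forall>x\<in>I. \<forall>a. a * x \<in> I \<and> x * a \<in> I)"

definition commutator_ideal :: "'a set" where
  "commutator_ideal = two_sided_ideal hull {commutator a b | a b. True}"

text \<open>The powers are indexed by \<open>k \<ge> 1\<close>; the value at \<open>0\<close> is a convention that
  \<open>nilpotent_ideal\<close> does not use.\<close>

fun ideal_power :: "'a set \<Rightarrow> nat \<Rightarrow> 'a set" where
  "ideal_power I 0 = UNIV"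
| "ideal_power I (Suc 0) = I"
| "ideal_power I (Suc (Suc k)) = span {x * y | x y. x \<in> ideal_power I (Suc k) \<and> y \<in> I}"

definition nilpotent_ideal :: "'a set \<Rightarrow> bool" where
  "nilpotent_ideal I \<longleftrightarrow> two_sided_ideal I \<and> (\<exists>k\<ge>1. ideal_power I k = {0})"

end

locale lie_algebra = vector_space scale
  for scale :: "'f::field \<Rightarrow> 'l::ab_group_add \<Rightarrow> 'l" (infixr \<open>*s\<close> 75) +
  fixes bracket :: "'l \<Rightarrow> 'l \<Rightarrow> 'l"
  assumes bracket_add_left: "bracket (x + y) z = bracket x z + bracket y z"
    and bracket_add_right: "bracket x (y + z) = bracket x y + bracket x z"
    and bracket_scale_left: "bracket (c *s x) y = c *s bracket x y"
    and bracket_scale_right: "bracket x (c *s y) = c *s bracket x y"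
    and bracket_self: "bracket x x = 0"
    and jacobi: "bracket x (bracket y z) + bracket y (bracket z x) + bracket z (bracket x y) = 0"
begin

primrec derived_series :: "nat \<Rightarrow> 'l set" where
  "derived_series 0 = UNIV"
| "derived_series (Suc n) =
     span {bracket x y | x y. x \<in> derived_series n \<and> y \<in> derived_series n}"

definition solvable :: bool where
  "solvable \<longleftrightarrow> (\<exists>n. derived_series n = {0})"

end

lemma (in assoc_algebra) lie_algebra_commutator: "lie_algebra scale commutator"
  by unfold_locales
    (simp_all add: commutator_def algebra_simps scale_mult_left scale_mult_right)

text \<open>The algebra is the internal direct sum of the family \<open>A\<close>: every element is
  the sum of a unique finitely supported family of homogeneous components.\<close>

locale graded_algebra = assoc_algebra scale + group G
  for scale :: "'f::field \<Rightarrow> 'a::ring \<Rightarrow> 'a" (infixr \<open>*s\<close> 75)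
    and G :: "('g, 'm) monoid_scheme" (structure) +
  fixes A :: "'g \<Rightarrow> 'a set"
  assumes component_subspace: "\<xi> \<in> carrier G \<Longrightarrow> subspace (A \<xi>)"
    and direct_sum: "\<exists>!f. (\<forall>\<xi>\<in>carrier G. f \<xi> \<in> A \<xi>) \<and> (\<forall>\<xi>. \<xi> \<notin> carrier G \<longrightarrow> f \<xi> = 0)
        \<and> finite {\<xi>. f \<xi> \<noteq> 0} \<and> a = (\<Sum>\<xi> | f \<xi> \<noteq> 0. f \<xi>)"
    and component_mult: "\<lbrakk>\<xi> \<in> carrier G; \<zeta> \<in> carrier G; x \<in> A \<xi>; y \<in> A \<zeta>\<rbrakk>
        \<Longrightarrow> x * y \<in> A (\<xi> \<otimes> \<zeta>)"

end

theory Submission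
  imports Defs "HOL-Algebra.Multiplicative_Group"
begin

text \<open>
  Fix a generator \<open>g\<close> of the group, let \<open>d\<close> be its order and write \<open>B k\<close> for the component of
  degree \<open>g\<^sup>k\<close>; then degrees are natural numbers modulo \<open>d\<close>, and every homogeneous product whose
  degree is divisible by \<open>d\<close> is central. The aim is one number \<open>N\<close> such that all products of \<open>N\<close>
  elements \<open>u[x,y]v\<close> with homogeneous \<open>u, x, y, v\<close> vanish. By multilinearity the same then holds
  for arbitrary \<open>u, x, y, v\<close>. Since a product of three elements of the commutator ideal is a sum
  of such \<open>u[x,y]v\<close>, the ideal is nilpotent, and the other two claims follow because the
  derived series and the products of commutators lie in its powers.

  Trace commutators. Call \<open>z = [a,b]\<close> a trace commutator if \<open>a\<close> and \<open>b\<close> have opposite degrees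
  \<open>i\<close> and \<open>-i\<close>. It is central, and \<open>[a,b]b' = -[a,b']b\<close>; hence multiplication by \<open>z\<close> makes
  elements of degree \<open>-i\<close> anticommute. On the other hand such an element commutes with every
  product of two, and so of any even number, of elements of degree \<open>i\<close>. As \<open>d\<close> is odd, there
  are products of an even number of elements of degree \<open>i\<close> whose total degree is \<open>-i\<close>: these
  both commute and, in the presence of \<open>z\<close>, anticommute with elements of degree \<open>-i\<close>. In
  characteristic different from 2 this gives \<open>z b b' = 0\<close> for \<open>b\<close> of degree \<open>-i\<close> and such a product
  \<open>b'\<close>, and from this a product of sufficiently many trace commutators is zero
  (\<open>all_trace_commutators_nilpotent\<close>). For even \<open>d\<close> this fails, as the infinite-dimensional Grassmann
  algebra graded by parity shows.

  Reduction to commuting opposite degrees. Filter the algebra by the annihilators of the products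
  of \<open>k\<close> trace commutators. On each quotient of two successive ideals trace commutators act as
  zero, so left multiplications by elements of opposite degree commute there. It remains to see
  that many factors \<open>u[x,y]v\<close> carry each ideal of this finite filtration into the next
  (\<open>homogeneous_commutators_carry\<close>).

  Regrouping. Among \<open>d\<close> consecutive homogeneous factors some consecutive block has degree zero.
  It is central and again of the form \<open>c = u[x,y]v\<close>. So only products of central \<open>c\<close>
  matter, and because these commute, they may be sorted by the degrees \<open>i, j\<close> of \<open>x, y\<close>.

  Central commutators. The subgroup generated by \<open>i\<close> and \<open>j\<close> is cyclic, generated by some
  \<open>h = p i + q j\<close>. Rotating degree zero words, the letters \<open>x\<close> of \<open>p\<close> factors and the letters
  \<open>y\<close> of \<open>q\<close> factors can be collected into one word of degree \<open>h\<close>; many factors thus yield a long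
  word in elements of degree \<open>h\<close>. Such a word annihilates \<open>[x,y]\<close>: a piece \<open>V\<close> of degree \<open>-i\<close> makes
  \<open>V x\<close> central, a piece \<open>U\<close> of degree \<open>-j\<close> makes \<open>U y\<close> central, so
  \<open>U V x y = U y V x = V U y x\<close>, and \<open>U, V\<close> commute with each other after enough letters
  of degree \<open>h\<close>. This is where it matters that the group is cyclic
  (\<open>commutator_killed_by_long_word\<close>).
\<close>

section \<open>Words acting by left multiplication\<close>

text \<open>In an algebra without a unit the empty word has no value. Letting words act on a last factor
  \<open>t\<close> avoids all case distinctions: the empty word acts as the identity.\<close>

abbreviation act :: "'a::ring list \<Rightarrow> 'a \<Rightarrow> 'a" where
  "act us t \<equiv> foldr (*) us t"

lemma act_add: "act us (s + t) = act us s + act us t"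
  by (induction us) (simp_all add: distrib_left)

lemma act_diff: "act us (s - t) = act us s - act us t"
  by (induction us) (simp_all add: right_diff_distrib)

lemma act_zero [simp]: "act us 0 = 0"
  by (induction us) simp_all

lemma act_mult_right: "act us t * x = act us (t * x)"
  by (induction us) (simp_all add: mult.assoc)

lemma algebra_centerD: "z \<in> algebra_center \<Longrightarrow> z * x = x * z"
  by (simp add: algebra_center_def)

lemma central_left_commute: "z \<in> algebra_center \<Longrightarrow> x * (z * y) = z * (x * y)"
  by (metis algebra_centerD mult.assoc)

lemma act_central_element: "z \<in> algebra_center \<Longrightarrow> act us (z * t) = z * act us t"
proof (induction us)
  case (Cons u us)
  then show ?case using central_left_commute[of z u "act us t"] by simp
qed simp

lemma act_central_list:
  "set zs \<subseteq> algebra_center \<Longrightarrow> act us (act zs t) = act zs (act us t)"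
  by (induction zs) (simp_all add: act_central_element)

lemma act_eq_product:
  assumes "us \<noteq> []" shows "act us t = act (butlast us) (last us) * t"
  using assms by (induction us) (auto simp: mult.assoc)

lemma diff_central:
  "x \<in> algebra_center \<Longrightarrow> y \<in> algebra_center \<Longrightarrow> x - y \<in> algebra_center"
  by (simp add: algebra_center_def left_diff_distrib right_diff_distrib)

definition left_closed :: "'a::ring set \<Rightarrow> bool" where
  "left_closed M \<longleftrightarrow> (\<forall>x. \<forall>t\<in>M. x * t \<in> M)"

text \<open>For \<open>L = UNIV\<close> and \<open>K = {0}\<close> this says that the set is nilpotent; in general it is nilpotency
  of \<open>S\<close> in its action from \<open>L\<close> modulo \<open>K\<close>, with a bound uniform in the factors.\<close>

definition carries :: "'a::ring set \<Rightarrow> 'a set \<Rightarrow> 'a set \<Rightarrow> bool" where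
  "carries S L K \<longleftrightarrow> (\<exists>n. \<forall>ss. set ss \<subseteq> S \<longrightarrow> length ss = n \<longrightarrow> (\<forall>t\<in>L. act ss t \<in> K))"

lemma act_in_left_closed: "left_closed M \<Longrightarrow> t \<in> M \<Longrightarrow> act us t \<in> M"
  by (induction us) (auto simp: left_closed_def)

lemma act_filter_central:
  assumes "set ss \<subseteq> algebra_center"
  shows "act ss t = act (filter P ss) (act (filter (\<lambda>x. \<not> P x) ss) t)"
  using assms
proof (induction ss)
  case (Cons x ss)
  then show ?case
    by (auto simp: act_central_element)
qed simp

lemma carries_subset: "S \<subseteq> T \<Longrightarrow> carries T L K \<Longrightarrow> carries S L K"
  unfolding carries_def by blast

lemma carriesE_long:
  assumes "carries S L K" "left_closed L"
  obtains n where "\<And>ss t. set ss \<subseteq> S \<Longrightarrow> n \<le> length ss \<Longrightarrow> t \<in> L \<Longrightarrow> act ss t \<in> K"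
proof -
  obtain n where n: "\<And>ss t. set ss \<subseteq> S \<Longrightarrow> length ss = n \<Longrightarrow> t \<in> L \<Longrightarrow> act ss t \<in> K"
    using assms unfolding carries_def by blast
  have "act ss t \<in> K" if "set ss \<subseteq> S" "n \<le> length ss" "t \<in> L" for ss t
  proof -
    have "act (take n ss) (act (drop n ss) t) \<in> K"
      using that assms(2) by (intro n act_in_left_closed) (auto dest: in_set_takeD)
    then show ?thesis
      by (metis append_take_drop_id comp_apply foldr_append)
  qed
  then show thesis by (rule that)
qed

text \<open>Central factors can be sorted, so a long product over \<open>S \<union> T\<close> contains a long product over
  one of the two sets.\<close>

lemma carries_Un:
  assumes S: "carries S L K" and T: "carries T L K"
    and closed: "left_closed L" "left_closed K"
    and central: "S \<union> T \<subseteq> algebra_center"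
  shows "carries (S \<union> T) L K"
proof -
  obtain m where m: "\<And>ss t. set ss \<subseteq> S \<Longrightarrow> m \<le> length ss \<Longrightarrow> t \<in> L \<Longrightarrow> act ss t \<in> K"
    using carriesE_long[OF S closed(1)] by blast
  obtain n where n: "\<And>ss t. set ss \<subseteq> T \<Longrightarrow> n \<le> length ss \<Longrightarrow> t \<in> L \<Longrightarrow> act ss t \<in> K"
    using carriesE_long[OF T closed(1)] by blast
  have "act ss t \<in> K" if ss: "set ss \<subseteq> S \<union> T" "length ss = m + n" and t: "t \<in> L" for ss t
  proof -
    let ?s = "filter (\<lambda>x. x \<in> S) ss" and ?t = "filter (\<lambda>x. x \<notin> S) ss"
    have eq: "act ss t = act ?s (act ?t t)"
      using ss central by (intro act_filter_central) blast
    have "length ?s + length ?t = m + n"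
      using ss(2) sum_length_filter_compl[of "\<lambda>x. x \<in> S" ss] by simp
    then consider "m \<le> length ?s" | "n \<le> length ?t" by linarith
    then show ?thesis
    proof cases
      case 1
      then show ?thesis unfolding eq
        using t closed by (intro m act_in_left_closed) auto
    next
      case 2
      have "act ?t t \<in> K"
        using 2 ss t by (intro n) auto
      then show ?thesis unfolding eq by (rule act_in_left_closed[OF closed(2)])
    qed
  qed
  then show ?thesis unfolding carries_def by blast
qed

lemma carries_UN:
  assumes "finite I" "\<And>i. i \<in> I \<Longrightarrow> carries (S i) L K"
    and "left_closed L" "left_closed K" "\<And>i. i \<in> I \<Longrightarrow> S i \<subseteq> algebra_center"
  shows "carries (\<Union>i\<in>I. S i) L K"
  using assms
proof (induction I rule: finite_induct)
  case empty
  then show ?case unfolding carries_def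
    by (intro exI[of _ 1]) auto
next
  case (insert i I)
  have "carries (S i \<union> (\<Union>i\<in>I. S i)) L K"
    using insert by (intro carries_Un) auto
  then show ?case by simp
qed

lemma carries_trans:
  assumes "carries S L K" "carries S K M"
  shows "carries S L M"
proof -
  obtain m where m: "\<And>ss t. set ss \<subseteq> S \<Longrightarrow> length ss = m \<Longrightarrow> t \<in> L \<Longrightarrow> act ss t \<in> K"
    using assms(1) unfolding carries_def by metis
  obtain n where n: "\<And>ss t. set ss \<subseteq> S \<Longrightarrow> length ss = n \<Longrightarrow> t \<in> K \<Longrightarrow> act ss t \<in> M"
    using assms(2) unfolding carries_def by metis
  have "act ss t \<in> M" if "set ss \<subseteq> S" "length ss = n + m" "t \<in> L" for ss t
  proof -
    have "act (take n ss) (act (drop n ss) t) \<in> M"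
      using that by (intro n m) (auto dest: in_set_takeD in_set_dropD)
    then show ?thesis by (metis append_take_drop_id comp_apply foldr_append)
  qed
  then show ?thesis unfolding carries_def by blast
qed

text \<open>The span of \<open>commutator_monomials UNIV\<close> contains all products of three elements of the
  commutator ideal. Requiring both outer factors avoids the four shapes of generators that an ideal without unit would need.\<close>

definition commutator_monomials :: "'a::ring set \<Rightarrow> 'a set" where
  "commutator_monomials H = {u * (commutator x y * v) | u x y v. u \<in> H \<and> x \<in> H \<and> y \<in> H \<and> v \<in> H}"

section \<open>Arithmetic of degrees\<close>

text \<open>Subgroups of a cyclic group are cyclic: by Bezout the subgroup generated by \<open>i\<close> and \<open>j\<close> is
  generated by one nonnegative combination \<open>h = p * i + q * j\<close>, so that \<open>-i\<close> and \<open>-j\<close> are multiples of \<open>h\<close>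
  modulo \<open>d\<close>.\<close>

lemma common_cyclic_degree:
  fixes d i j :: nat
  assumes "0 < d"
  obtains p q m n where "0 < p + q" "d dvd m * (p * i + q * j) + i" "d dvd n * (p * i + q * j) + j"
proof (cases "i = 0")
  case True
  have "(d - 1) * j + j = d * j" using assms by (cases d) simp_all
  then show thesis using True that[of 0 1 0 "d - 1"] by simp
next
  case False
  define g where "g = gcd i j"
  obtain x y where xy: "i * x = j * y + g"
    using bezout_nat[OF False, of j] unfolding g_def by blast
  have "g > 0" using False by (simp add: g_def)
  then have "x > 0" using xy by (cases x) auto
  \<comment> \<open>Modulo \<open>d\<close> the factor \<open>d - 1\<close> is \<open>-1\<close>, so \<open>h\<close> represents the Bezout combination \<open>x i - y j = g\<close>.\<close>
  define h where "h = x * i + ((d - 1) * y) * j"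
  have h: "h = g + d * (y * j)"
    using xy assms by (cases d) (simp_all add: h_def algebra_simps)
  have key: "d dvd ((d - 1) * (e div g)) * h + e" if "g dvd e" for e
  proof -
    define c where "c = d - 1"
    have "((d - 1) * (e div g)) * h + e = (d - 1) * (e div g * g) + e + d * ((d - 1) * (e div g) * (y * j))"
      unfolding h c_def[symmetric] by (simp add: algebra_simps)
    also have "(d - 1) * (e div g * g) + e = d * e" using that assms by (cases d) simp_all
    finally show ?thesis by simp
  qed
  show thesis
    using \<open>x > 0\<close> key[of i] key[of j] that[of x "(d - 1) * y" "(d - 1) * (i div g)" "(d - 1) * (j div g)"]
    by (simp add: g_def h_def)
qed

text \<open>Two of the \<open>d + 1\<close> initial sums agree modulo \<open>d\<close>; the block lies between them.\<close>

lemma zero_sum_block: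
  fixes ks :: "nat list"
  assumes "length ks = d" "0 < d"
  obtains a b where "a < b" "b \<le> d" "d dvd sum_list (take (b - a) (drop a ks))"
proof -
  define f where "f a = sum_list (take a ks) mod d" for a
  have "f ` {..d} \<subseteq> {..<d}" using assms by (auto simp: f_def)
  then have "card (f ` {..d}) < card {..d}"
    using card_mono[of "{..<d}" "f ` {..d}"] by simp
  then have "\<not> inj_on f {..d}" by (rule pigeonhole)
  then obtain a b where ab: "a < b" "b \<le> d" "f a = f b"
    unfolding inj_on_def by (metis atMost_iff linorder_neqE_nat)
  have "take b ks = take a ks @ take (b - a) (drop a ks)"
    using ab(1) by (metis add_diff_inverse_nat less_imp_le not_le take_add)
  then have "sum_list (take b ks) = sum_list (take a ks) + sum_list (take (b - a) (drop a ks))"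
    by simp
  then have "d dvd sum_list (take (b - a) (drop a ks))"
    using ab(3) unfolding f_def by (metis add_diff_cancel_left' le_add1 mod_eq_dvd_iff_nat)
  with ab(1,2) show thesis by (rule that)
qed

section \<open>Trace commutators\<close>

text \<open>Both sides are equal to \<open>a' b a\<close>: move the central \<open>b a\<close> on the left and the central
  \<open>a' b\<close> on the right.\<close>

lemma opposite_commutes_with_pair:
  assumes "b * a \<in> algebra_center" "a' * b \<in> algebra_center"
  shows "b * (a * a') = a * (a' * b)"
proof -
  have "b * (a * a') = a' * (b * a)"
    using assms(1) by (metis algebra_centerD mult.assoc)
  also have "\<dots> = a * (a' * b)"
    using assms(2) by (metis algebra_centerD mult.assoc)
  finally show ?thesis .
qed

text \<open>The linearised form of \<open>[a,b] b = 0\<close>, which holds because \<open>a b b = b a b\<close> for central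
  \<open>a b\<close>.\<close>

lemma trace_commutator_exchange:
  assumes "a * b \<in> algebra_center" "a * b' \<in> algebra_center"
  shows "(a * b - b * a) * b' = - ((a * b' - b' * a) * b)"
proof -
  have "a * b * b' = b' * (a * b)" "a * b' * b = b * (a * b')"
    using assms algebra_centerD by blast+
  then show ?thesis by (simp add: algebra_simps)
qed

text \<open>A cyclic grading indexed by all natural numbers, periodic with period \<open>d\<close>. The opposite of the
  degree \<open>i\<close> is then any \<open>j\<close> with \<open>d dvd i + j\<close>, and no subtraction of degrees is needed.\<close>

locale cyclically_graded_ring =
  fixes B :: "nat \<Rightarrow> 'a::ring set" and d :: nat
  assumes odd_d: "odd d"
    and B_diff: "x \<in> B k \<Longrightarrow> y \<in> B k \<Longrightarrow> x - y \<in> B k"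
    and B_mult: "x \<in> B k \<Longrightarrow> y \<in> B l \<Longrightarrow> x * y \<in> B (k + l)"
    and B_mod: "B (k mod d) = B k"
    and B_0_central: "B 0 \<subseteq> algebra_center"
    and no_2_torsion: "(x::'a) + x = 0 \<Longrightarrow> x = 0"
begin

lemma d_pos: "0 < d"
  using odd_d by (simp add: odd_pos)

lemma B_central: "d dvd k \<Longrightarrow> x \<in> B k \<Longrightarrow> x \<in> algebra_center"
  using B_0_central B_mod[of k] by auto

lemma product_in_B:
  assumes "us \<noteq> []" "list_all2 (\<lambda>u k. u \<in> B k) us ks"
  shows "act (butlast us) (last us) \<in> B (sum_list ks)"
  using assms(2,1)
proof (induction rule: list_all2_induct)
  case (Cons u us k ks)
  then show ?case using B_mult[of u k] by (cases us) auto
qed simp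

lemma list_all2_replicate_degree:
  "set us \<subseteq> B h \<Longrightarrow> list_all2 (\<lambda>u k. u \<in> B k) us (replicate (length us) h)"
  by (induction us) auto

lemma power_in_B:
  "us \<noteq> [] \<Longrightarrow> set us \<subseteq> B h \<Longrightarrow> act (butlast us) (last us) \<in> B (length us * h)"
  using product_in_B[OF _ list_all2_replicate_degree] by (simp add: sum_list_replicate)

lemma act_central_word:
  assumes "set us \<subseteq> B h" "y \<in> B j" "d dvd length us * h + j"
  shows "act us (y * act ws t) = act ws (act us (y * t))"
proof -
  let ?p = "act us y"
  have p: "act us (y * s) = ?p * s" for s by (simp add: act_mult_right)
  have "?p \<in> B (length us * h + j)"
    using assms(1,2)
  proof (induction us)
    case (Cons u us)
    then show ?case using B_mult[of u h "act us y"] by (simp add: add.assoc)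
  qed simp
  then have "?p \<in> algebra_center" using assms(3) B_central by blast
  then show ?thesis by (simp add: p act_central_element)
qed

definition trace_commutators :: "nat \<Rightarrow> 'a set" where
  "trace_commutators i = {a * b - b * a | a b j. a \<in> B i \<and> b \<in> B j \<and> d dvd i + j}"

lemma trace_commutators_central: "trace_commutators i \<subseteq> algebra_center"
proof
  fix z assume "z \<in> trace_commutators i"
  then obtain a b j where *: "z = a * b - b * a" "a \<in> B i" "b \<in> B j" "d dvd i + j"
    unfolding trace_commutators_def by blast
  have "a * b \<in> B (i + j)" "b * a \<in> B (i + j)"
    using * B_mult by (force simp: add.commute)+
  then show "z \<in> algebra_center" using * B_diff B_central by blast
qed

lemma mult_opposite_central:
  assumes "a \<in> B i" "b \<in> B j" "d dvd i + j"
  shows "a * b \<in> algebra_center" "b * a \<in> algebra_center" "a * b - b * a \<in> algebra_center"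
proof -
  show 1: "a * b \<in> algebra_center" using assms B_mult B_central by blast
  show 2: "b * a \<in> algebra_center" using assms B_mult B_central by (metis add.commute)
  show "a * b - b * a \<in> algebra_center" using 1 2 by (rule diff_central)
qed

text \<open>Pairs suffice: \<open>b\<close> passes the letters two at a time. It need not pass a single letter.\<close>

lemma opposite_commutes_with_even_word:
  assumes b: "b \<in> B j" "d dvd i + j"
  shows "set as \<subseteq> B i \<Longrightarrow> even (length as) \<Longrightarrow> b * act as t = act as (b * t)"
proof (induction as rule: induct_list012)
  case (3 a a' as)
  have "b * (a * a') = a * (a' * b)"
    using 3(3) b by (intro opposite_commutes_with_pair mult_opposite_central) auto
  then have "b * (a * (a' * act as t)) = a * (a' * (b * act as t))"
    by (metis mult.assoc)
  with 3 show ?case by simp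
qed auto

text \<open>The second slot of \<open>[a,b]\<close> can be exchanged with \<open>b'\<close> and with \<open>b''\<close>, each time at the cost of
  a sign. The transposition of \<open>b'\<close> and \<open>b''\<close> is a product of three such exchanges.\<close>

lemma trace_commutator_alternating:
  assumes a: "a \<in> B i" and b: "b \<in> B j" "d dvd i + j"
    and b': "b' \<in> B j'" "d dvd i + j'" and b'': "b'' \<in> B j''" "d dvd i + j''"
  shows "(a * b - b * a) * (b' * b'') = - ((a * b - b * a) * (b'' * b'))"
proof -
  note c = mult_opposite_central[OF a b] mult_opposite_central[OF a b']
    mult_opposite_central[OF a b'']
  have "(a * b - b * a) * (b' * b'') = ((a * b - b * a) * b') * b''"
    by (simp only: mult.assoc)
  also have "\<dots> = - ((a * b' - b' * a) * b) * b''"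
    by (simp only: trace_commutator_exchange[OF c(1) c(4)])
  also have "\<dots> = - (b * ((a * b' - b' * a) * b''))"
    by (simp only: algebra_centerD[OF c(6)] mult_minus_left mult.assoc)
  also have "\<dots> = b * ((a * b'' - b'' * a) * b')"
    by (simp only: trace_commutator_exchange[OF c(4) c(7)]) simp
  also have "\<dots> = (a * b'' - b'' * a) * b * b'"
    by (simp only: algebra_centerD[OF c(9), of b] mult.assoc)
  also have "\<dots> = - ((a * b - b * a) * b'' * b')"
    by (simp only: trace_commutator_exchange[OF c(7) c(1)]) simp
  finally show ?thesis by (simp only: mult.assoc)
qed

text \<open>The length \<open>3 * d - 1\<close> is congruent to \<open>-1\<close>, so the word \<open>as\<close> has the degree of \<open>b\<close> and
  anticommutes with \<open>b\<close> in the presence of \<open>z\<close>; its length is even because \<open>d\<close> is odd, so the word also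
  commutes with \<open>b\<close>. Adding \<open>2 * d\<close> to the length \<open>d - 1\<close>, which has the
  same two properties, keeps the word nonempty when \<open>d = 1\<close>.\<close>

lemma trace_commutator_kills_mixed_word:
  assumes z: "z \<in> trace_commutators i" and b: "b \<in> B j" "d dvd i + j"
    and as: "set as \<subseteq> B i" "length as = 3 * d - 1"
  shows "z * (b * act as t) = 0"
proof -
  obtain a b0 j0 where *: "z = a * b0 - b0 * a" "a \<in> B i" "b0 \<in> B j0" "d dvd i + j0"
    using z unfolding trace_commutators_def by blast
  have ne: "as \<noteq> []" using as(2) d_pos by auto
  define p where "p = act (butlast as) (last as)"
  have p: "act as s = p * s" for s unfolding p_def using ne by (rule act_eq_product)
  have pB: "p \<in> B (length as * i)" unfolding p_def using ne as(1) by (rule power_in_B)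
  have "i + length as * i = d * (3 * i)"
    using as(2) d_pos by (simp add: diff_mult_distrib)
  then have dvd: "d dvd i + length as * i" by simp
  have alt: "z * (b * p) = - (z * (p * b))"
    unfolding *(1) using *(2-4) b pB dvd by (rule trace_commutator_alternating)
  have "even (length as)" using as(2) odd_d d_pos by simp
  then have "b * act as t = act as (b * t)"
    using b as(1) opposite_commutes_with_even_word by blast
  then have bp: "b * (p * t) = p * (b * t)" by (simp add: p)
  have "z * (b * (p * t)) = z * (b * p) * t" by (simp only: mult.assoc)
  also have "\<dots> = - (z * (p * (b * t)))" by (simp only: alt mult_minus_left mult.assoc)
  also have "\<dots> = - (z * (b * (p * t)))" by (simp only: bp)
  finally have "z * (b * (p * t)) + z * (b * (p * t)) = 0"
    by (simp add: eq_neg_iff_add_eq_0)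
  then show ?thesis unfolding p by (rule no_2_torsion)
qed

text \<open>Each further trace commutator shortens the word needed for vanishing by one letter: expanding
  the last commutator as \<open>a b - b a\<close>, either term contains a word longer by the letter \<open>a\<close>, once \<open>a b\<close> is moved to
  the right end and \<open>b\<close> to the left end. At length zero, only trace commutators remain.\<close>

lemma trace_commutator_words_vanish:
  assumes "set zs \<subseteq> trace_commutators i" "length zs = k + 2"
    and "set as \<subseteq> B i" "length as + k = 3 * d - 1"
  shows "act zs (act as t) = 0"
  using assms
proof (induction k arbitrary: zs as t)
  case 0
  then obtain z z' where zs: "zs = [z, z']" by (auto simp: length_Suc_conv numeral_2_eq_2)
  obtain a b j where *: "z' = a * b - b * a" "a \<in> B i" "b \<in> B j" "d dvd i + j"
    using 0 zs unfolding trace_commutators_def by auto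
  have zc: "z \<in> algebra_center" and zt: "z \<in> trace_commutators i"
    using 0 zs trace_commutators_central by auto
  have "z * (b * act as t) = 0"
    using zt * 0 by (intro trace_commutator_kills_mixed_word) auto
  then have 1: "z * (a * (b * act as t)) = 0"
    using central_left_commute[OF zc, of a "b * act as t"] by simp
  have ne: "as \<noteq> []" using 0 d_pos by auto
  then have "act as t = act (butlast as @ [last as]) t" by simp
  then have "act as t = act (butlast as) (last as * t)" by (simp del: append_butlast_last_id)
  then have "z * (b * (a * act as t)) = z * (b * act (a # butlast as) (last as * t))" by simp
  also have "\<dots> = 0"
    using zt * 0 ne d_pos
    by (intro trace_commutator_kills_mixed_word) (auto dest: in_set_butlastD)
  finally show ?case using 1 by (simp add: zs *(1) left_diff_distrib right_diff_distrib mult.assoc)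
next
  case (Suc k)
  define zs' z where "zs' = butlast zs" and "z = last zs"
  have zs: "zs = zs' @ [z]" using Suc.prems unfolding zs'_def z_def
    by (metis append_butlast_last_id list.size(3) add_2_eq_Suc' nat.distinct(1))
  then obtain a b j where *: "z = a * b - b * a" "a \<in> B i" "b \<in> B j" "d dvd i + j"
    using Suc.prems unfolding trace_commutators_def by auto
  have zs': "set zs' \<subseteq> trace_commutators i" "length zs' = k + 2" using Suc.prems zs by auto
  then have cen: "set zs' \<subseteq> algebra_center" using trace_commutators_central by blast
  have "a * b * act as t = act (as @ [a]) (b * t)"
    using act_central_element[OF mult_opposite_central(1)[OF *(2-4)], of as t]
    by (simp add: mult.assoc)
  also have "act zs' \<dots> = 0" using zs' Suc.prems *(2) by (intro Suc.IH) auto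
  finally have 1: "act zs' (a * b * act as t) = 0" .
  have "act zs' (act [b] (act (a # as) t)) = act [b] (act zs' (act (a # as) t))"
    using act_central_list[OF cen] by metis
  also have "act zs' (act (a # as) t) = 0" using zs' Suc.prems *(2) by (intro Suc.IH) auto
  finally have 2: "act zs' (b * a * act as t) = 0" by (simp add: mult.assoc)
  show ?case using 1 2 by (simp add: zs * left_diff_distrib act_diff)
qed

lemma trace_commutators_nilpotent: "carries (trace_commutators i) UNIV {0}"
proof -
  have "act zs t = 0" if "set zs \<subseteq> trace_commutators i" "length zs = (3 * d - 1) + 2" for zs t
    using trace_commutator_words_vanish[of zs i "3 * d - 1" "[]" t] that by simp
  then show ?thesis unfolding carries_def by blast
qed

lemma all_trace_commutators_nilpotent: "carries (\<Union>i. trace_commutators i) UNIV {0}"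
proof -
  have "trace_commutators i \<subseteq> trace_commutators (i mod d)" for i
    unfolding trace_commutators_def B_mod by (auto simp: dvd_eq_mod_eq_0 mod_simps)
  moreover have "i mod d \<in> {..<d}" for i using d_pos by simp
  ultimately have "(\<Union>i. trace_commutators i) = (\<Union>i\<in>{..<d}. trace_commutators i)"
    by blast
  moreover have "carries (\<Union>i\<in>{..<d}. trace_commutators i) UNIV {0}"
    using trace_commutators_nilpotent trace_commutators_central
    by (intro carries_UN) (auto simp: left_closed_def)
  ultimately show ?thesis by simp
qed

section \<open>Commutators of homogeneous elements\<close>

text \<open>The elements \<open>u [x,y] v\<close> of total degree zero, sorted by the degrees of \<open>x\<close> and \<open>y\<close>.\<close>

definition central_commutators :: "nat \<Rightarrow> nat \<Rightarrow> 'a set" where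
  "central_commutators i j = {c. \<exists>u k v l x y. u \<in> B k \<and> v \<in> B l \<and> x \<in> B i \<and> y \<in> B j \<and>
     d dvd k + i + j + l \<and> c = u * (x * (y * v)) - u * (y * (x * v))}"

abbreviation homogeneous_commutators :: "'a set" where
  "homogeneous_commutators \<equiv> commutator_monomials (\<Union>k. B k)"

lemma homogeneous_commutatorE:
  assumes "c \<in> homogeneous_commutators"
  obtains u k v l x i y j where "u \<in> B k" "v \<in> B l" "x \<in> B i" "y \<in> B j"
    "c = u * (x * (y * v)) - u * (y * (x * v))"
proof -
  obtain u v x y where "u \<in> (\<Union>k. B k)" "v \<in> (\<Union>k. B k)" "x \<in> (\<Union>k. B k)" "y \<in> (\<Union>k. B k)"
    "c = u * (commutator x y * v)"
    using assms unfolding commutator_monomials_def by blast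
  then show thesis
    using that by (auto simp: commutator_def left_diff_distrib right_diff_distrib mult.assoc)
qed

lemma commutator_homogeneous:
  assumes "u \<in> B k" "v \<in> B l" "x \<in> B i" "y \<in> B j"
  shows "u * (x * (y * v)) - u * (y * (x * v)) \<in> B (k + i + j + l)"
proof -
  have "u * (x * (y * v)) \<in> B (k + (i + (j + l)))" "u * (y * (x * v)) \<in> B (k + (j + (i + l)))"
    by (intro B_mult assms)+
  then show ?thesis by (intro B_diff) (simp_all add: ac_simps)
qed

lemma central_commutators_central: "central_commutators i j \<subseteq> algebra_center"
  unfolding central_commutators_def using commutator_homogeneous B_central by blast

text \<open>The letters after the first commutator are absorbed into its right factor \<open>v\<close>.\<close>

lemma homogeneous_commutator_block:
  assumes g: "u \<in> B k" "v \<in> B l" "x \<in> B i" "y \<in> B j"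
    and ws: "list_all2 (\<lambda>w k. w \<in> B k) ws ks" "d dvd (k + i + j + l) + sum_list ks"
  shows "\<exists>c\<in>central_commutators i j.
    \<forall>t. act ((u * (x * (y * v)) - u * (y * (x * v))) # ws) t = c * t"
proof -
  define v' where "v' = act (butlast (v # ws)) (last (v # ws))"
  have v': "v * act ws t = v' * t" for t
    unfolding v'_def using act_eq_product[of "v # ws" t] by simp
  have "v' \<in> B (l + sum_list ks)"
    unfolding v'_def using product_in_B[of "v # ws" "l # ks"] ws g by simp
  moreover have "d dvd k + i + j + (l + sum_list ks)" using ws(2) by (simp add: add.assoc)
  ultimately have "u * (x * (y * v')) - u * (y * (x * v')) \<in> central_commutators i j"
    using g unfolding central_commutators_def by blast
  then show ?thesis
    by (intro bexI[of _ "u * (x * (y * v')) - u * (y * (x * v'))"])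
      (simp_all add: left_diff_distrib mult.assoc v')
qed

lemma extract_central_commutator:
  assumes gs: "set gs \<subseteq> homogeneous_commutators" "length gs = d"
  shows "\<exists>c\<in>(\<Union>i j. central_commutators i j). \<exists>ws. \<forall>t. act gs t = c * act ws t"
proof -
  have "\<exists>D. \<exists>u k v l x i y j. u \<in> B k \<and> v \<in> B l \<and> x \<in> B i \<and> y \<in> B j \<and>
      g = u * (x * (y * v)) - u * (y * (x * v)) \<and> D = k + i + j + l" if "g \<in> set gs" for g
  proof -
    have "g \<in> homogeneous_commutators" using that gs(1) by blast
    then show ?thesis by (elim homogeneous_commutatorE) blast
  qed
  then obtain D where D: "\<And>g. g \<in> set gs \<Longrightarrow> \<exists>u k v l x i y j.
      u \<in> B k \<and> v \<in> B l \<and> x \<in> B i \<and> y \<in> B j \<and>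
      g = u * (x * (y * v)) - u * (y * (x * v)) \<and> D g = k + i + j + l"
    by metis
  have D_degree: "g \<in> B (D g)" if "g \<in> set gs" for g
    using D[OF that] commutator_homogeneous by metis
  obtain a b where ab: "a < b" "b \<le> d" "d dvd sum_list (take (b - a) (drop a (map D gs)))"
    using zero_sum_block[of "map D gs" d] gs(2) d_pos by auto
  define blk where "blk = take (b - a) (drop a gs)"
  have gs_eq: "gs = take a gs @ blk @ drop b gs"
    unfolding blk_def using ab(1)
    by (metis append_take_drop_id drop_drop le_add_diff_inverse2 less_imp_le)
  have "blk \<noteq> []" unfolding blk_def using ab gs(2) by simp
  then obtain g ws where blk: "blk = g # ws" by (cases blk) auto
  have mem: "g \<in> set gs" "set ws \<subseteq> set gs"
    using blk by (subst gs_eq; auto)+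
  obtain u k v l x i y j where g: "u \<in> B k" "v \<in> B l" "x \<in> B i" "y \<in> B j"
    "g = u * (x * (y * v)) - u * (y * (x * v))" "D g = k + i + j + l"
    using D[OF mem(1)] by blast
  have "sum_list (take (b - a) (drop a (map D gs))) = D g + sum_list (map D ws)"
    by (metis blk blk_def drop_map list.simps(9) sum_list.Cons take_map)
  then have dvd: "d dvd (k + i + j + l) + sum_list (map D ws)"
    using ab(3) g(6) by simp
  have ws: "list_all2 (\<lambda>w k. w \<in> B k) ws (map D ws)"
    using mem(2) D_degree by (auto simp: list_all2_map2 list_all2_same)
  obtain c where c: "c \<in> central_commutators i j" "\<And>t. act (g # ws) t = c * t"
    using homogeneous_commutator_block[OF g(1-4) ws dvd] g(5) by blast
  have "act gs t = c * act (take a gs @ drop b gs) t" for t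
  proof -
    have "act gs t = act (take a gs) (act (g # ws) (act (drop b gs) t))"
      by (subst gs_eq) (simp only: blk foldr_append comp_apply)
    also have "\<dots> = c * act (take a gs) (act (drop b gs) t)"
      using c(1) central_commutators_central unfolding c(2)
      by (intro act_central_element) blast
    finally show ?thesis by simp
  qed
  with c(1) show ?thesis by blast
qed

text \<open>Each run of \<open>d\<close> factors contains a central commutator, which can be moved to the front; the
  letters left over end up in \<open>ws\<close>.\<close>

lemma extract_central_commutators:
  assumes "set gs \<subseteq> homogeneous_commutators" "length gs = n * d"
  shows "\<exists>cs ws. length cs = n \<and> set cs \<subseteq> (\<Union>i j. central_commutators i j) \<and>
    (\<forall>t. act gs t = act cs (act ws t))"
  using assms
proof (induction n arbitrary: gs)
  case 0
  then show ?case by (intro exI[of _ "[]"]) simp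
next
  case (Suc n)
  define gs1 gs2 where "gs1 = take d gs" and "gs2 = drop d gs"
  have gs: "gs = gs1 @ gs2" "length gs1 = d" "length gs2 = n * d"
    "set gs1 \<subseteq> homogeneous_commutators" "set gs2 \<subseteq> homogeneous_commutators"
    using Suc.prems unfolding gs1_def gs2_def by (auto dest: in_set_takeD in_set_dropD)
  obtain c ws where c: "c \<in> (\<Union>i j. central_commutators i j)" "\<And>t. act gs1 t = c * act ws t"
    using extract_central_commutator[OF gs(4,2)] by blast
  obtain cs ws' where cs: "length cs = n" "set cs \<subseteq> (\<Union>i j. central_commutators i j)"
    "\<And>t. act gs2 t = act cs (act ws' t)"
    using Suc.IH[OF gs(5,3)] by blast
  have "set cs \<subseteq> algebra_center" using cs(2) central_commutators_central by blast
  then have "act gs t = act (c # cs) (act (ws @ ws') t)" for t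
    using act_central_list[of cs ws "act ws' t"] by (simp add: gs(1) c(2) cs(3))
  moreover have "length (c # cs) = Suc n" "set (c # cs) \<subseteq> (\<Union>i j. central_commutators i j)"
    using c(1) cs(1,2) by auto
  ultimately show ?case by blast
qed

end

section \<open>Commutators of degree zero when opposite degrees commute\<close>

text \<open>One layer of a filtration by left ideals on which trace commutators act as zero: left
  multiplications by elements of opposite degrees commute as maps from \<open>L\<close> to the quotient modulo \<open>K\<close>.\<close>

locale graded_layer = cyclically_graded_ring B d
  for B :: "nat \<Rightarrow> 'a::ring set" and d +
  fixes L K :: "'a set"
  assumes L_closed: "left_closed L" and K_closed: "left_closed K"
    and K_zero: "0 \<in> K" and K_diff: "s \<in> K \<Longrightarrow> t \<in> K \<Longrightarrow> s - t \<in> K"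
    and opposite_commute:
      "\<lbrakk>x \<in> B i; y \<in> B j; d dvd i + j; t \<in> L\<rbrakk> \<Longrightarrow> x * (y * t) - y * (x * t) \<in> K"
begin

definition eqv :: "'a \<Rightarrow> 'a \<Rightarrow> bool" (infix \<open>\<approx>\<close> 50) where
  "s \<approx> t \<longleftrightarrow> s - t \<in> K"

lemma K_add: "s \<in> K \<Longrightarrow> t \<in> K \<Longrightarrow> s + t \<in> K"
  using K_diff[of s "0 - t"] K_diff[of 0 t] K_zero by simp

lemma eqv_refl [simp]: "t \<approx> t"
  by (simp add: eqv_def K_zero)

lemma eqv_sym: "s \<approx> t \<Longrightarrow> t \<approx> s"
  unfolding eqv_def using K_diff[of 0 "s - t"] K_zero by simp

lemma eqv_trans [trans]: "r \<approx> s \<Longrightarrow> s \<approx> t \<Longrightarrow> r \<approx> t"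
  unfolding eqv_def using K_add[of "r - s" "s - t"] by simp

lemma eqv_mult: "s \<approx> t \<Longrightarrow> x * s \<approx> x * t"
  unfolding eqv_def using K_closed by (simp add: left_closed_def flip: right_diff_distrib)

lemma eqv_act: "s \<approx> t \<Longrightarrow> act us s \<approx> act us t"
  by (induction us) (auto intro: eqv_mult)

lemma eqv_opposite:
  "x \<in> B i \<Longrightarrow> y \<in> B j \<Longrightarrow> d dvd i + j \<Longrightarrow> t \<in> L \<Longrightarrow> x * (y * t) \<approx> y * (x * t)"
  unfolding eqv_def by (rule opposite_commute)

lemma L_mult: "t \<in> L \<Longrightarrow> x * t \<in> L"
  using L_closed by (simp add: left_closed_def)

lemma L_act: "t \<in> L \<Longrightarrow> act us t \<in> L"
  using L_closed by (rule act_in_left_closed)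

lemma eqv_opposite_word:
  assumes "x \<in> B i" "set us \<subseteq> B h" "d dvd i + length us * h" "t \<in> L"
  shows "x * act us t \<approx> act us (x * t)"
proof (cases "us = []")
  case False
  show ?thesis
    unfolding act_eq_product[OF False]
    by (rule eqv_opposite[OF assms(1) power_in_B[OF False assms(2)] assms(3,4)])
qed simp

text \<open>The last \<open>d - 1\<close> letters form a word \<open>Q\<close> of degree \<open>-h\<close>. As \<open>Q y\<close> is central,
  \<open>Q y x = x Q y\<close>; as \<open>x\<close> and \<open>Q\<close> have opposite degrees, \<open>x Q y \<approx> Q x y\<close>.\<close>

lemma same_degree_commute_after_word:
  assumes us: "set us \<subseteq> B h" "d - 1 \<le> length us" and xy: "x \<in> B h" "y \<in> B h"
    and t: "t \<in> L"
  shows "act us (y * (x * t)) \<approx> act us (x * (y * t))"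
proof -
  define n where "n = length us - (d - 1)"
  define P Q where "P = take n us" and "Q = drop n us"
  have PQ: "us = P @ Q" and Q: "set Q \<subseteq> B h" "length Q = d - 1"
    using us unfolding P_def Q_def n_def by (auto dest: in_set_dropD)
  have "length Q * h + h = d * h" using Q d_pos by (cases d) simp_all
  then have dvd: "d dvd length Q * h + h" "d dvd h + length Q * h" by (simp_all add: add.commute)
  have "act Q (y * act [x] t) = x * act Q (y * t)"
    using act_central_word[OF Q(1) xy(2) dvd(1), of "[x]" t] by simp
  also have "\<dots> \<approx> act Q (x * (y * t))"
    using xy Q dvd t by (intro eqv_opposite_word) (auto intro: L_mult)
  finally show ?thesis unfolding PQ by (simp add: eqv_act)
qed

lemma move_letter_through_word:
  assumes "set (P @ us) \<subseteq> B h" "d - 1 \<le> length P" "x \<in> B h" "t \<in> L"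
  shows "act P (x * act us t) \<approx> act P (act us (x * t))"
  using assms
proof (induction us arbitrary: P)
  case (Cons u us)
  have "act P (x * (u * act us t)) \<approx> act P (u * (x * act us t))"
    using Cons.prems by (intro same_degree_commute_after_word) (auto intro: L_act)
  also have "\<dots> \<approx> act P (u * act us (x * t))"
    using Cons.IH[of "P @ [u]"] Cons.prems by simp
  finally show ?case by simp
qed simp

lemma commute_words_after_word:
  assumes "set (P @ us @ vs) \<subseteq> B h" "d - 1 \<le> length P" "t \<in> L"
  shows "act P (act us (act vs t)) \<approx> act P (act vs (act us t))"
  using assms
proof (induction us arbitrary: P)
  case (Cons u us)
  have "act P (u * act us (act vs t)) \<approx> act P (u * act vs (act us t))"
    using Cons.IH[of "P @ [u]"] Cons.prems by simp
  also have "\<dots> \<approx> act P (act vs (u * act us t))"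
    using Cons.prems by (intro move_letter_through_word) (auto intro: L_act)
  finally show ?case by simp
qed simp

text \<open>Split the word as \<open>P U V\<close> with \<open>V x\<close> and \<open>U y\<close> of degree zero, hence central. Then
  \<open>P U V x y = P U y V x = P V U y x \<approx> P U V y x\<close>, the prefix \<open>P\<close> serving only to exchange \<open>U\<close> and \<open>V\<close>.\<close>

lemma commutator_killed_by_long_word:
  assumes us: "set us \<subseteq> B h" "length us = (d - 1) + n + m"
    and x: "x \<in> B i" "d dvd m * h + i" and y: "y \<in> B j" "d dvd n * h + j"
    and t: "t \<in> L"
  shows "act us (x * (y * t)) \<approx> act us (y * (x * t))"
proof -
  define P U V where "P = take (d - 1) us" and "U = take n (drop (d - 1) us)"
    and "V = drop n (drop (d - 1) us)"
  have us_eq: "us = P @ U @ V" and len: "length P = d - 1" "length U = n" "length V = m"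
    using us(2) unfolding P_def U_def V_def by (simp_all del: drop_drop)
  have "act V (x * (y * t)) = y * act V (x * t)"
    using act_central_word[of V h x i "[y]" t] us x len by (simp add: us_eq)
  then have "act us (x * (y * t)) = act P (act U (y * act V (x * t)))" by (simp add: us_eq)
  also have "\<dots> = act P (act V (act U (y * (x * t))))"
    using us y len by (subst act_central_word[of U h y j]) (auto simp: us_eq)
  also have "\<dots> \<approx> act P (act U (act V (y * (x * t))))"
    using us len t by (intro commute_words_after_word) (auto simp: us_eq intro: L_mult)
  finally show ?thesis by (simp add: us_eq)
qed

text \<open>The word \<open>ws\<close> can be rotated to the right end of \<open>es\<close>, leaving the other letters on its left.\<close>

definition yields :: "'a list \<Rightarrow> 'a list \<Rightarrow> bool" where
  "yields es ws \<longleftrightarrow> (\<exists>rs. \<forall>t\<in>L. act es t \<approx> act rs (act ws t))"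

lemma yields_Nil: "yields [] []"
  unfolding yields_def by (intro exI[of _ "[]"]) simp

text \<open>The central word \<open>es\<close> passes the remainder left by \<open>es'\<close>, after which it can yield its
  own letters next to \<open>ws'\<close>.\<close>

lemma yields_append:
  assumes "yields es ws" "yields es' ws'" "set es \<subseteq> algebra_center"
  shows "yields (es @ es') (ws @ ws')"
proof -
  obtain rs where rs: "\<And>t. t \<in> L \<Longrightarrow> act es t \<approx> act rs (act ws t)"
    using assms(1) unfolding yields_def by blast
  obtain rs' where rs': "\<And>t. t \<in> L \<Longrightarrow> act es' t \<approx> act rs' (act ws' t)"
    using assms(2) unfolding yields_def by blast
  have "act (es @ es') t \<approx> act (rs' @ rs) (act (ws @ ws') t)" if "t \<in> L" for t
  proof -
    have "act es (act es' t) \<approx> act es (act rs' (act ws' t))"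
      using rs' that by (intro eqv_act)
    also have "\<dots> = act rs' (act es (act ws' t))"
      using assms(3) by (simp add: act_central_list)
    also have "\<dots> \<approx> act rs' (act rs (act ws (act ws' t)))"
      using rs that by (intro eqv_act) (auto intro: L_act)
    finally show ?thesis by simp
  qed
  then show ?thesis unfolding yields_def by blast
qed

lemma yields_letters:
  assumes "\<And>e. e \<in> set es \<Longrightarrow> e \<in> algebra_center \<and> (\<exists>x\<in>B i. yields [e] [x])"
  shows "\<exists>ws. length ws = length es \<and> set ws \<subseteq> B i \<and> yields es ws"
  using assms
proof (induction es)
  case Nil
  then show ?case using yields_Nil by auto
next
  case (Cons e es)
  then obtain x ws where "x \<in> B i" "yields [e] [x]"
    "length ws = length es" "set ws \<subseteq> B i" "yields es ws" by fastforce
  with Cons.prems[of e] yields_append[of "[e]" "[x]" es ws] show ?case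
    by (intro exI[of _ "x # ws"]) simp
qed

text \<open>The two terms of a central commutator, expanded.\<close>

definition monomials :: "nat \<Rightarrow> nat \<Rightarrow> 'a set" where
  "monomials i j = {e. \<exists>u k v l x y. u \<in> B k \<and> v \<in> B l \<and> x \<in> B i \<and> y \<in> B j \<and>
     d dvd k + i + j + l \<and> (e = u * (x * (y * v)) \<or> e = u * (y * (x * v)))}"

lemma monomial_central_yields:
  assumes "u \<in> B k" "v \<in> B l" "x \<in> B i" "y \<in> B j" "d dvd k + i + j + l"
    and e: "e = u * (x * (y * v))"
  shows "e \<in> algebra_center" "yields [e] [x]" "yields [e] [y]"
proof -
  have "u * (x * (y * v)) \<in> B (k + (i + (j + l)))" using assms by (intro B_mult)
  then show "e \<in> algebra_center" using assms(5) e B_central by (simp add: add.assoc)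
  have "u * x \<in> B (k + i)" "y * v \<in> B (j + l)" using assms by (auto intro: B_mult)
  moreover have "d dvd (k + i) + (j + l)" using assms(5) by (simp add: add.assoc)
  ultimately have "act [e] t \<approx> act [y * v, u] (act [x] t)" if "t \<in> L" for t
    using eqv_opposite[of "u * x" "k + i" "y * v" "j + l" t] that
    by (simp add: e mult.assoc)
  then show "yields [e] [x]" unfolding yields_def by blast
  have "u * (x * y) \<in> B (k + (i + j))" using assms by (auto intro: B_mult)
  moreover have "d dvd (k + (i + j)) + l" using assms(5) by (simp add: add.assoc)
  ultimately have "act [e] t \<approx> act [v, u, x] (act [y] t)" if "t \<in> L" for t
    using eqv_opposite[of "u * (x * y)" "k + (i + j)" v l t] that assms(2)
    by (simp add: e mult.assoc)
  then show "yields [e] [y]" unfolding yields_def by blast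
qed

lemma monomials_central_yield:
  assumes "e \<in> monomials i j"
  shows "e \<in> algebra_center \<and> (\<exists>x\<in>B i. yields [e] [x]) \<and> (\<exists>y\<in>B j. yields [e] [y])"
proof -
  obtain u k v l x y where *: "u \<in> B k" "v \<in> B l" "x \<in> B i" "y \<in> B j" "d dvd k + i + j + l"
    and "e = u * (x * (y * v)) \<or> e = u * (y * (x * v))"
    using assms unfolding monomials_def by blast
  then consider "e = u * (x * (y * v))" | "e = u * (y * (x * v))" by blast
  then show ?thesis
  proof cases
    case 1
    with monomial_central_yields[OF *] * show ?thesis by blast
  next
    case 2
    have "d dvd k + j + i + l" using *(5) by (simp add: ac_simps)
    with 2 monomial_central_yields[OF *(1,2,4,3)] * show ?thesis by blast
  qed
qed

text \<open>Either kind of monomial can yield its letter of degree \<open>i\<close> or its letter of degree \<open>j\<close>. The first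
  \<open>s\<close> monomials are asked for the former, the last \<open>t\<close> for the latter.\<close>

lemma monomials_yield_degree:
  assumes "set es \<subseteq> monomials i j" "length es = s + t" "0 < s + t"
  shows "\<exists>w\<in>B (s * i + t * j). yields es [w]"
proof -
  define es1 es2 where "es1 = take s es" and "es2 = drop s es"
  have es: "es = es1 @ es2" "length es1 = s" "length es2 = t"
    "set es1 \<subseteq> monomials i j" "set es2 \<subseteq> monomials i j"
    using assms unfolding es1_def es2_def by (auto dest: in_set_takeD in_set_dropD)
  obtain us where us: "length us = s" "set us \<subseteq> B i" "yields es1 us"
    using yields_letters[of es1 i] es monomials_central_yield by blast
  obtain vs where vs: "length vs = t" "set vs \<subseteq> B j" "yields es2 vs"
    using yields_letters[of es2 j] es monomials_central_yield by blast
  have "yields es (us @ vs)" unfolding es(1)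
    using us vs es monomials_central_yield by (intro yields_append) auto
  moreover define w where "w = act (butlast (us @ vs)) (last (us @ vs))"
  have ne: "us @ vs \<noteq> []" using us vs assms(3) by auto
  have "act (us @ vs) r = w * r" for r unfolding w_def by (rule act_eq_product[OF ne])
  ultimately have "yields es [w]" unfolding yields_def by simp
  moreover have "list_all2 (\<lambda>u k. u \<in> B k) (us @ vs) (replicate s i @ replicate t j)"
    using list_all2_replicate_degree us vs by (intro list_all2_appendI) auto
  from product_in_B[OF ne this] have "w \<in> B (s * i + t * j)"
    by (simp add: w_def sum_list_replicate)
  ultimately show ?thesis by blast
qed

lemma monomials_yield_word:
  assumes "set es \<subseteq> monomials i j" "length es = n * (s + t)" "0 < s + t"
  shows "\<exists>ws. length ws = n \<and> set ws \<subseteq> B (s * i + t * j) \<and> yields es ws"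
  using assms(1,2)
proof (induction n arbitrary: es)
  case 0
  then show ?case using yields_Nil by auto
next
  case (Suc n)
  define es1 es2 where "es1 = take (s + t) es" and "es2 = drop (s + t) es"
  have es: "es = es1 @ es2" "length es1 = s + t" "length es2 = n * (s + t)"
    "set es1 \<subseteq> monomials i j" "set es2 \<subseteq> monomials i j"
    using Suc.prems unfolding es1_def es2_def by (auto dest: in_set_takeD in_set_dropD)
  obtain w where w: "w \<in> B (s * i + t * j)" "yields es1 [w]"
    using monomials_yield_degree[OF es(4,2) assms(3)] by blast
  obtain ws where ws: "length ws = n" "set ws \<subseteq> B (s * i + t * j)" "yields es2 ws"
    using Suc.IH es by blast
  have "yields es ([w] @ ws)" unfolding es(1)
    using w ws es monomials_central_yield by (intro yields_append) auto
  then show ?case using w ws by (intro exI[of _ "w # ws"]) auto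
qed

text \<open>Modulo \<open>K\<close>, the factor \<open>u\<close> rotates to the right, so that the commutator \<open>[x,y]\<close> stands directly
  behind the central word \<open>es\<close>, and \<open>es\<close> yields a word long enough to annihilate it. The
  difference of the two terms is left expanded, since each is rotated on its own.\<close>

lemma commutator_monomial_product_vanishes:
  assumes u: "u \<in> B k" "v \<in> B l" and x: "x \<in> B i" "d dvd m * (p * i + q * j) + i"
    and y: "y \<in> B j" "d dvd n * (p * i + q * j) + j" and deg: "d dvd k + i + j + l"
    and es: "set es \<subseteq> monomials i j" "length es = ((d - 1) + n + m) * (p + q)" "0 < p + q"
    and t: "t \<in> L"
  shows "u * (x * (y * v)) * act es t - u * (y * (x * v)) * act es t \<in> K"
proof -
  have cen: "set es \<subseteq> algebra_center" using es monomials_central_yield by blast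
  have xyv: "x * (y * v) \<in> B (i + j + l)" "y * (x * v) \<in> B (i + j + l)"
    using u x y B_mult[of x i "y * v" "j + l"] B_mult[of y j "x * v" "i + l"]
      B_mult[of y j v l] B_mult[of x i v l] by (simp_all add: ac_simps)
  have deg': "d dvd k + (i + j + l)" using deg by (simp add: ac_simps)
  define r where "r = v * (u * t)"
  have r: "r \<in> L" unfolding r_def using t by (intro L_mult)
  obtain ws where ws: "length ws = (d - 1) + n + m" "set ws \<subseteq> B (p * i + q * j)" "yields es ws"
    using monomials_yield_word[OF es] by blast
  then obtain rs where rs: "\<And>t. t \<in> L \<Longrightarrow> act es t \<approx> act rs (act ws t)"
    unfolding yields_def by blast
  have move: "c * act es t = act es (c * t)" for c
    using act_central_list[OF cen, of "[c]"] by simp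
  have "u * (x * (y * v)) * act es t = act es (u * ((x * (y * v)) * t))"
    by (simp add: move mult.assoc)
  also have "\<dots> \<approx> act es (x * (y * r))"
    using eqv_opposite[OF u(1) xyv(1) deg' t] unfolding r_def mult.assoc by (rule eqv_act)
  also have "\<dots> \<approx> act rs (act ws (x * (y * r)))"
    using r by (intro rs L_mult)
  also have "\<dots> \<approx> act rs (act ws (y * (x * r)))"
    using commutator_killed_by_long_word[OF ws(2,1) x y r] by (rule eqv_act)
  also have "\<dots> \<approx> act es (y * (x * r))"
    using r by (intro eqv_sym[OF rs] L_mult)
  also have "\<dots> \<approx> act es (u * ((y * (x * v)) * t))"
    using eqv_sym[OF eqv_opposite[OF u(1) xyv(2) deg' t]] unfolding r_def mult.assoc
    by (rule eqv_act)
  also have "\<dots> = u * (y * (x * v)) * act es t"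
    by (simp add: move mult.assoc)
  finally show ?thesis by (simp add: eqv_def)
qed

text \<open>Only the first commutator is kept as a difference; all others are expanded into
  monomials, which are there to yield the annihilating word.\<close>

lemma central_commutators_carry: "carries (central_commutators i j) L K"
proof -
  obtain p q m n where pq: "0 < p + q" "d dvd m * (p * i + q * j) + i"
    "d dvd n * (p * i + q * j) + j"
    using common_cyclic_degree[OF d_pos] by metis
  define N where "N = ((d - 1) + n + m) * (p + q)"
  have "act (c # cs) t \<in> K"
    if "c \<in> central_commutators i j" "set cs \<subseteq> central_commutators i j"
      "length cs = N" "t \<in> L" for c cs t
  proof -
    obtain u k v l x y where c: "u \<in> B k" "v \<in> B l" "x \<in> B i" "y \<in> B j" "d dvd k + i + j + l"
      "c = u * (x * (y * v)) - u * (y * (x * v))"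
      using \<open>c \<in> _\<close> unfolding central_commutators_def by blast
    have "c * act es (act cs' t) \<in> K"
      if "set es \<subseteq> monomials i j" "set cs' \<subseteq> central_commutators i j"
        "length es + length cs' = N" for es cs'
      using that
    proof (induction cs' arbitrary: es)
      case Nil
      have "u * (x * (y * v)) * act es t - u * (y * (x * v)) * act es t \<in> K"
        using Nil c pq \<open>t \<in> L\<close> unfolding N_def
        by (intro commutator_monomial_product_vanishes[of u k v l x i m p q j y n]) auto
      then show ?case by (simp add: c(6) left_diff_distrib)
    next
      case (Cons c' cs')
      obtain e e' where e: "e \<in> monomials i j" "e' \<in> monomials i j" "c' = e - e'"
        using Cons.prems unfolding central_commutators_def monomials_def by auto blast
      have "c * act (es @ [e]) (act cs' t) \<in> K" "c * act (es @ [e']) (act cs' t) \<in> K"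
        using Cons.prems e by (intro Cons.IH; simp)+
      then have "c * act (es @ [e]) (act cs' t) - c * act (es @ [e']) (act cs' t) \<in> K"
        by (rule K_diff)
      then show ?case by (simp add: e(3) left_diff_distrib right_diff_distrib act_diff)
    qed
    from this[of "[]" cs] show ?thesis using that by simp
  qed
  then have "act cs t \<in> K"
    if "set cs \<subseteq> central_commutators i j" "length cs = Suc N" "t \<in> L" for cs t
    using that by (cases cs) auto
  then show ?thesis unfolding carries_def by blast
qed

lemma all_central_commutators_carry: "carries (\<Union>i j. central_commutators i j) L K"
proof -
  have "central_commutators i j \<subseteq> central_commutators (i mod d) (j mod d)" for i j
  proof -
    have "d dvd k + i mod d + j mod d + l" if "d dvd k + i + j + l" for k l
    proof -
      have "k + i + j + l = (k + i mod d + j mod d + l) + d * (i div d + j div d)"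
        using mod_mult_div_eq[of i d] mod_mult_div_eq[of j d] unfolding distrib_left by linarith
      then show ?thesis using that by (metis dvd_add_left_iff dvd_triv_left)
    qed
    then show ?thesis unfolding central_commutators_def B_mod by blast
  qed
  moreover have "i mod d \<in> {..<d}" for i using d_pos by simp
  ultimately have "(\<Union>i j. central_commutators i j)
      = (\<Union>(i, j)\<in>{..<d} \<times> {..<d}. central_commutators i j)"
    by blast
  moreover have "carries (\<Union>(i, j)\<in>{..<d} \<times> {..<d}. central_commutators i j) L K"
    using central_commutators_carry central_commutators_central L_closed K_closed
    by (intro carries_UN) (auto simp del: subset_iff split: prod.splits)
  ultimately show ?thesis by simp
qed

lemma homogeneous_commutators_carry: "carries homogeneous_commutators L K"
proof -
  let ?C = "\<Union>i j. central_commutators i j"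
  obtain n where n: "\<And>cs t. set cs \<subseteq> ?C \<Longrightarrow> length cs = n \<Longrightarrow> t \<in> L \<Longrightarrow> act cs t \<in> K"
    using all_central_commutators_carry unfolding carries_def by metis
  have "act gs t \<in> K" if "set gs \<subseteq> homogeneous_commutators" "length gs = n * d" "t \<in> L"
    for gs t
  proof -
    obtain cs ws where "length cs = n" "set cs \<subseteq> ?C" "\<And>t. act gs t = act cs (act ws t)"
      using extract_central_commutators[OF \<open>set gs \<subseteq> _\<close> \<open>length gs = _\<close>] by blast
    then show ?thesis using n L_act \<open>t \<in> L\<close> by simp
  qed
  then show ?thesis unfolding carries_def by blast
qed

end

section \<open>Filtration by annihilators of trace commutators\<close>

context cyclically_graded_ring
begin

text \<open>These ideals increase with \<open>k\<close> from \<open>{0}\<close> to the whole ring, since long products of trace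
  commutators vanish; and a trace commutator maps each of them into the previous one.\<close>

definition annihilator :: "nat \<Rightarrow> 'a set" where
  "annihilator k = {t. \<forall>zs. set zs \<subseteq> (\<Union>i. trace_commutators i) \<longrightarrow> length zs = k \<longrightarrow> act zs t = 0}"

lemma annihilator_layer: "graded_layer B d (annihilator (Suc k)) (annihilator k)"
proof unfold_locales
  have closed: "left_closed (annihilator l)" for l
  proof -
    have "act zs (x * t) = 0" if "t \<in> annihilator l"
      "set zs \<subseteq> (\<Union>i. trace_commutators i)" "length zs = l" for x t zs
    proof -
      have "set zs \<subseteq> algebra_center" using that(2) trace_commutators_central by blast
      then have "act zs (x * t) = x * act zs t" using act_central_list[of zs "[x]" t] by simp
      then show ?thesis using that by (simp add: annihilator_def)
    qed
    then show ?thesis unfolding left_closed_def annihilator_def by blast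
  qed
  show "left_closed (annihilator (Suc k))" "left_closed (annihilator k)"
    by (rule closed)+
  show "0 \<in> annihilator k" by (simp add: annihilator_def)
  show "s - t \<in> annihilator k" if "s \<in> annihilator k" "t \<in> annihilator k" for s t
    using that by (simp add: annihilator_def act_diff)
  show "x * (y * t) - y * (x * t) \<in> annihilator k"
    if "x \<in> B i" "y \<in> B j" "d dvd i + j" "t \<in> annihilator (Suc k)" for x i y j t
  proof -
    have annihilatorD: "act zs t = 0"
      if "set zs \<subseteq> (\<Union>i. trace_commutators i)" "length zs = Suc k" for zs
      using \<open>t \<in> annihilator (Suc k)\<close> that unfolding annihilator_def by blast
    have z: "x * y - y * x \<in> trace_commutators i"
      using that unfolding trace_commutators_def by blast
    have "act zs (x * (y * t) - y * (x * t)) = 0"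
      if zs: "set zs \<subseteq> (\<Union>i. trace_commutators i)" "length zs = k" for zs
    proof -
      have "act (zs @ [x * y - y * x]) t = 0"
        using zs z by (intro annihilatorD) auto
      then show ?thesis by (simp add: left_diff_distrib mult.assoc)
    qed
    then show ?thesis by (simp add: annihilator_def)
  qed
qed

lemma homogeneous_commutators_nilpotent: "carries homogeneous_commutators UNIV {0}"
proof -
  have "carries homogeneous_commutators (annihilator k) {0}" for k
  proof (induction k)
    case 0
    show ?case unfolding carries_def by (intro exI[of _ 0]) (auto simp: annihilator_def)
  next
    case (Suc k)
    interpret graded_layer B d "annihilator (Suc k)" "annihilator k"
      by (rule annihilator_layer)
    show ?case using homogeneous_commutators_carry Suc.IH by (rule carries_trans)
  qed
  moreover obtain n where "\<And>zs t. set zs \<subseteq> (\<Union>i. trace_commutators i) \<Longrightarrow> length zs = n \<Longrightarrow> act zs t = 0"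
    using all_trace_commutators_nilpotent unfolding carries_def by (metis UNIV_I singletonD)
  then have "annihilator n = UNIV" unfolding annihilator_def by blast
  ultimately show ?thesis by metis
qed

end

section \<open>From homogeneous elements to the commutator ideal\<close>

context assoc_algebra
begin

lemma act_scale: "act us (scale c t) = scale c (act us t)"
  by (induction us) (simp_all add: scale_mult_right)

lemma carries_span:
  assumes "carries S UNIV {0}"
  shows "carries (span S) UNIV {0}"
proof -
  obtain n where n: "\<And>ss t. set ss \<subseteq> S \<Longrightarrow> length ss = n \<Longrightarrow> act ss t = 0"
    using assms unfolding carries_def by (metis UNIV_I singletonD)
  have "act ss (act xs t) = 0"
    if "set ss \<subseteq> S" "set xs \<subseteq> span S" "length ss + length xs = n" for ss xs t
    using that
  proof (induction xs arbitrary: ss)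
    case Nil
    then show ?case using n by simp
  next
    case (Cons x xs)
    have "x \<in> span S" using Cons.prems by simp
    then have "act ss (x * act xs t) = 0"
    proof (induction rule: span_induct)
      case (step x)
      then show ?case using Cons.IH[of "ss @ [x]"] Cons.prems by simp
    next
      case base
      show ?case
        by (auto simp: subspace_def distrib_right act_add scale_mult_left act_scale)
    qed
    then show ?case by simp
  qed
  from this[of "[]"] have "act xs t = 0" if "set xs \<subseteq> span S" "length xs = n" for xs t
    using that by simp
  then show ?thesis unfolding carries_def by blast
qed

text \<open>Linearity in each of the four arguments, extended to the span one argument at a time.\<close>

lemma commutator_monomials_span:
  "commutator_monomials (span H) \<subseteq> span (commutator_monomials H)"
proof -
  let ?V = "span (commutator_monomials H)"
  have 1: "u * (commutator x y * v) \<in> ?V" if "u \<in> H" "x \<in> H" "y \<in> H" "v \<in> H" for u x y v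
    using that unfolding commutator_monomials_def by (blast intro: span_base)
  have 2: "u * (commutator x y * v) \<in> ?V" if "u \<in> span H" "x \<in> H" "y \<in> H" "v \<in> H" for u x y v
    using that(1)
  proof (induction rule: span_induct)
    case base
    show ?case by (auto simp: subspace_def distrib_right scale_mult_left intro: span_add span_scale span_zero)
  qed (use 1 that in auto)
  have 3: "u * (commutator x y * v) \<in> ?V"
    if "u \<in> span H" "x \<in> span H" "y \<in> H" "v \<in> H" for u x y v
    using that(2)
  proof (induction rule: span_induct)
    case base
    have "u * (commutator (x + x') y * v) = u * (commutator x y * v) + u * (commutator x' y * v)"
      "u * (commutator (scale c x) y * v) = scale c (u * (commutator x y * v))" for x x' c
      by (simp_all add: commutator_def algebra_simps scale_mult_left scale_mult_right)
    then show ?case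
      by (auto simp: subspace_def intro: span_add span_scale) (simp add: commutator_def span_zero)
  qed (use 2 that in auto)
  have 4: "u * (commutator x y * v) \<in> ?V"
    if "u \<in> span H" "x \<in> span H" "y \<in> span H" "v \<in> H" for u x y v
    using that(3)
  proof (induction rule: span_induct)
    case base
    have "u * (commutator x (y + y') * v) = u * (commutator x y * v) + u * (commutator x y' * v)"
      "u * (commutator x (scale c y) * v) = scale c (u * (commutator x y * v))" for y y' c
      by (simp_all add: commutator_def algebra_simps scale_mult_left scale_mult_right)
    then show ?case
      by (auto simp: subspace_def intro: span_add span_scale) (simp add: commutator_def span_zero)
  qed (use 3 that in auto)
  have 5: "u * (commutator x y * v) \<in> ?V"
    if "u \<in> span H" "x \<in> span H" "y \<in> span H" "v \<in> span H" for u x y v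
    using that(4)
  proof (induction rule: span_induct)
    case base
    show ?case by (auto simp: subspace_def distrib_left scale_mult_right intro: span_add span_scale span_zero)
  qed (use 4 that in auto)
  show ?thesis unfolding commutator_monomials_def[of "span H"] using 5 by blast
qed

lemma two_sided_ideal_commutator_ideal: "two_sided_ideal commutator_ideal"
  unfolding commutator_ideal_def
  by (rule hull_in) (auto simp: two_sided_ideal_def subspace_Inter)

lemma commutator_in_commutator_ideal: "commutator x y \<in> commutator_ideal"
  unfolding commutator_ideal_def by (rule hull_inc) blast

text \<open>The elements with this property form a two-sided ideal, and commutators have it.\<close>

lemma commutator_ideal_two_sided_product:
  assumes "x \<in> commutator_ideal"
  shows "u * (x * v) \<in> span (commutator_monomials UNIV)"
proof -
  let ?V = "span (commutator_monomials UNIV)"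
  let ?J = "{x. \<forall>u v. u * (x * v) \<in> ?V}"
  have "two_sided_ideal ?J"
  proof -
    have "u * (a * x * v) \<in> ?V \<and> u * (x * a * v) \<in> ?V" if "x \<in> ?J" for x a u v
    proof -
      have "u * a * (x * v) \<in> ?V" "u * (x * (a * v)) \<in> ?V" using that by blast+
      then show ?thesis by (simp add: mult.assoc)
    qed
    moreover have "subspace ?J"
      by (auto simp: subspace_def distrib_left distrib_right scale_mult_left scale_mult_right
          intro: span_add span_scale span_zero)
    ultimately show ?thesis unfolding two_sided_ideal_def by blast
  qed
  moreover have "{commutator a b | a b. True} \<subseteq> ?J"
    unfolding commutator_monomials_def by (auto intro!: span_base)
  ultimately have "commutator_ideal \<subseteq> ?J"
    unfolding commutator_ideal_def by (intro hull_minimal)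
  then show ?thesis using assms by blast
qed

lemma carries_commutator_ideal:
  assumes "carries (commutator_monomials UNIV) (UNIV :: 'a set) {0}"
  obtains n where "\<And>xs t. set xs \<subseteq> commutator_ideal \<Longrightarrow> length xs = n \<Longrightarrow> act xs t = 0"
proof -
  obtain n where n: "\<And>ss t. set ss \<subseteq> span (commutator_monomials UNIV) \<Longrightarrow> length ss = n \<Longrightarrow> act ss t = 0"
    using carries_span[OF assms] unfolding carries_def by (metis UNIV_I singletonD)
  have group: "\<exists>ss. set ss \<subseteq> span (commutator_monomials UNIV) \<and> length ss = m \<and>
      (\<forall>t. act xs t = act ss t)"
    if "set xs \<subseteq> commutator_ideal" "length xs = 3 * m" for xs m
    using that
  proof (induction m arbitrary: xs)
    case 0
    then show ?case by auto
  next
    case (Suc m)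
    then obtain x y z xs' where xs: "xs = x # y # z # xs'"
      by (auto simp: length_Suc_conv numeral_3_eq_3)
    then obtain ss where ss: "set ss \<subseteq> span (commutator_monomials UNIV)" "length ss = m"
      "\<forall>t. act xs' t = act ss t"
      using Suc.IH[of xs'] Suc.prems by auto
    have "x * (y * z) \<in> span (commutator_monomials UNIV)"
      using Suc.prems xs by (intro commutator_ideal_two_sided_product) simp
    with ss show ?case
      by (intro exI[of _ "x * (y * z) # ss"]) (simp add: xs mult.assoc)
  qed
  have "act xs t = 0" if "set xs \<subseteq> commutator_ideal" "length xs = 3 * n" for xs t
    using group[OF that] n by metis
  then show thesis by (rule that)
qed

lemma ideal_power_Suc_subset_span:
  "ideal_power I (Suc k) \<subseteq> span {act xs y | xs y. set xs \<subseteq> I \<and> length xs = k \<and> y \<in> I}"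
proof (induction k)
  case 0
  show ?case by (auto intro: span_base)
next
  case (Suc k)
  let ?P = "\<lambda>k. {act xs y | xs y. set xs \<subseteq> I \<and> length xs = k \<and> y \<in> I}"
  have "x * z \<in> span (?P (Suc k))" if "x \<in> span (?P k)" "z \<in> I" for x z
    using that(1)
  proof (induction rule: span_induct)
    case (step x)
    then obtain xs y where "x = act xs y" "set xs \<subseteq> I" "length xs = k" "y \<in> I" by blast
    then have "x * z = act (xs @ [y]) z" "set (xs @ [y]) \<subseteq> I" "length (xs @ [y]) = Suc k"
      by (simp_all add: act_mult_right)
    then show ?case using that(2) by (blast intro: span_base)
  next
    case base
    show ?case
      by (auto simp: subspace_def distrib_right scale_mult_left intro: span_add span_scale span_zero)
  qed
  then have "{x * z | x z. x \<in> ideal_power I (Suc k) \<and> z \<in> I} \<subseteq> span (?P (Suc k))"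
    using Suc.IH by blast
  from span_minimal[OF this subspace_span] show ?case by simp
qed

lemma ideal_power_commutator_ideal_zero:
  assumes "carries (commutator_monomials UNIV) (UNIV :: 'a set) {0}"
  shows "\<exists>k\<ge>1. ideal_power commutator_ideal k = {0}"
proof -
  obtain n where n: "\<And>xs t. set xs \<subseteq> commutator_ideal \<Longrightarrow> length xs = n \<Longrightarrow> act xs t = 0"
    by (rule carries_commutator_ideal[OF assms]) blast
  have "act xs t = 0" if "set xs \<subseteq> commutator_ideal" "length xs = Suc n" for xs t
    using that n by (cases xs) auto
  then have "{act xs y | xs y. set xs \<subseteq> commutator_ideal \<and> length xs = Suc n \<and> y \<in> commutator_ideal}
      \<subseteq> {0}" by blast
  then have "ideal_power commutator_ideal (Suc (Suc n)) \<subseteq> span {0}"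
    using ideal_power_Suc_subset_span[of commutator_ideal "Suc n"] span_mono by blast
  moreover have "0 \<in> ideal_power commutator_ideal (Suc (Suc n))" by (simp add: span_zero)
  ultimately have "ideal_power commutator_ideal (Suc (Suc n)) = {0}" by auto
  then show ?thesis by (intro exI[of _ "Suc (Suc n)"]) simp
qed

lemma subspace_ideal_power: "subspace I \<Longrightarrow> subspace (ideal_power I k)"
  by (induction I k rule: ideal_power.induct) auto

lemma ideal_power_mult:
  "1 \<le> k \<Longrightarrow> x \<in> ideal_power I k \<Longrightarrow> y \<in> I \<Longrightarrow> x * y \<in> ideal_power I (Suc k)"
  by (cases k) (auto intro: span_base)

text \<open>Each step of the derived series gains one factor from the ideal, as its terms lie both in the
  ideal and in a power of it.\<close>

lemma derived_series_subset_ideal_power: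
  defines "D \<equiv> lie_algebra.derived_series scale commutator"
  shows "D (Suc n) \<subseteq> commutator_ideal \<inter> ideal_power commutator_ideal (Suc n)"
proof -
  interpret lie_algebra scale commutator by (rule lie_algebra_commutator)
  have sub: "subspace commutator_ideal"
    using two_sided_ideal_commutator_ideal by (simp add: two_sided_ideal_def)
  have I: "D (Suc n) \<subseteq> commutator_ideal" for n
  proof -
    have "{commutator x y | x y. x \<in> D n \<and> y \<in> D n} \<subseteq> commutator_ideal"
      using commutator_in_commutator_ideal by blast
    from span_minimal[OF this sub] show ?thesis by (simp add: D_def)
  qed
  have "D (Suc n) \<subseteq> ideal_power commutator_ideal (Suc n)"
  proof (induction n)
    case 0
    show ?case using I[of 0] by simp
  next
    case (Suc n)
    have "commutator x y \<in> ideal_power commutator_ideal (Suc (Suc n))"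
      if "x \<in> D (Suc n)" "y \<in> D (Suc n)" for x y
      unfolding commutator_def using that Suc.IH I[of n]
      by (intro subspace_diff subspace_ideal_power sub ideal_power_mult) auto
    then have "{commutator x y | x y. x \<in> D (Suc n) \<and> y \<in> D (Suc n)}
        \<subseteq> ideal_power commutator_ideal (Suc (Suc n))" by blast
    from span_minimal[OF this subspace_ideal_power[OF sub]]
    show ?case by (simp add: D_def)
  qed
  with I show ?thesis by blast
qed

lemma ordered_prod_in_ideal_power:
  assumes "\<And>i. x i \<in> I"
  shows "ordered_prod x (Suc n) \<in> ideal_power I (Suc n)"
proof (induction n)
  case 0
  show ?case using assms by (simp add: ordered_prod_def)
next
  case (Suc n)
  have "ordered_prod x (Suc (Suc n)) = ordered_prod x (Suc n) * x (Suc (Suc n))"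
    by (simp add: ordered_prod_def)
  then show ?case using ideal_power_mult[OF _ Suc.IH assms] by simp
qed

lemma commutator_nilpotence_consequences:
  assumes "carries (commutator_monomials UNIV) (UNIV :: 'a set) {0}"
  shows "nilpotent_ideal commutator_ideal"
    and "lie_algebra.solvable scale commutator"
    and "\<exists>n\<ge>1. \<forall>a :: nat \<Rightarrow> 'a. ordered_prod (\<lambda>i. commutator (a (2 * i - 1)) (a (2 * i))) n = 0"
proof -
  interpret L: lie_algebra scale commutator by (rule lie_algebra_commutator)
  obtain k where k: "k \<ge> 1" "ideal_power commutator_ideal k = {0}"
    using ideal_power_commutator_ideal_zero[OF assms] by blast
  then obtain n where n: "k = Suc n" by (cases k) auto
  show "nilpotent_ideal commutator_ideal"
    unfolding nilpotent_ideal_def using two_sided_ideal_commutator_ideal k by blast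
  have "L.derived_series k \<subseteq> {0}"
    using derived_series_subset_ideal_power[of n] k by (auto simp: n)
  moreover have "0 \<in> L.derived_series k" by (simp add: n span_zero)
  ultimately have "L.derived_series k = {0}" by blast
  then show "L.solvable" unfolding L.solvable_def by blast
  have "ordered_prod (\<lambda>i. commutator (a (2 * i - 1)) (a (2 * i))) k = 0" for a :: "nat \<Rightarrow> 'a"
    using ordered_prod_in_ideal_power[of "\<lambda>i. commutator (a (2 * i - 1)) (a (2 * i))"
        commutator_ideal n] commutator_in_commutator_ideal k(2)
    unfolding n by blast
  with k show "\<exists>n\<ge>1. \<forall>a :: nat \<Rightarrow> 'a. ordered_prod (\<lambda>i. commutator (a (2 * i - 1)) (a (2 * i))) n = 0"
    by blast
qed

end

section \<open>Algebras graded by a cyclic group of odd order\<close>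

theorem theorem3p17:
  fixes scale :: "'f::field_char_0 \<Rightarrow> 'a::ring \<Rightarrow> 'a"
    and G :: "('g, 'm) monoid_scheme"
    and A :: "'g \<Rightarrow> 'a set"
  assumes "graded_algebra scale G A"
    and "cyclic_group G"
    and "finite (carrier G)"
    and "odd (order G)"
    and "A \<one>\<^bsub>G\<^esub> \<subseteq> algebra_center"
  shows "assoc_algebra.nilpotent_ideal scale (assoc_algebra.commutator_ideal scale)
    \<and> (lie_algebra scale (commutator :: 'a \<Rightarrow> 'a \<Rightarrow> 'a)
        \<and> lie_algebra.solvable scale (commutator :: 'a \<Rightarrow> 'a \<Rightarrow> 'a))
    \<and> (\<exists>n\<ge>1. \<forall>a :: nat \<Rightarrow> 'a.
          ordered_prod (\<lambda>i. commutator (a (2 * i - 1)) (a (2 * i))) n = 0)"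
proof -
  interpret graded_algebra scale G A by (rule assms(1))
  obtain g where g: "g \<in> carrier G" "carrier G = range (\<lambda>n::int. g [^]\<^bsub>G\<^esub> n)"
    using assms(2) unfolding cyclic_group by blast
  have powers: "\<exists>k::nat. \<xi> = g [^]\<^bsub>G\<^esub> k" if "\<xi> \<in> carrier G" for \<xi>
    using that generate_pow_on_finite_carrier[OF assms(3) g(1)] generate_pow[OF g(1)] g(2) by blast
  define B where "B = (\<lambda>k::nat. A (g [^]\<^bsub>G\<^esub> k))"
  have g_order: "g [^]\<^bsub>G\<^esub> order G = \<one>\<^bsub>G\<^esub>" using g(1) by (rule pow_order_eq_1)
  interpret cyclically_graded_ring B "order G"
  proof
    show "odd (order G)" by (rule assms(4))
    show "x - y \<in> B k" if "x \<in> B k" "y \<in> B k" for x y k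
      using that component_subspace g(1) unfolding B_def by (intro subspace_diff) auto
    show "x * y \<in> B (k + l)" if "x \<in> B k" "y \<in> B l" for x y k l
      using that component_mult g(1) unfolding B_def by (simp flip: nat_pow_mult)
    show "B (k mod order G) = B k" for k
    proof -
      have "g [^]\<^bsub>G\<^esub> k = g [^]\<^bsub>G\<^esub> (k mod order G + order G * (k div order G))" by simp
      also have "\<dots> = g [^]\<^bsub>G\<^esub> (k mod order G)"
        using g(1) g_order by (simp only: nat_pow_mult[symmetric] nat_pow_pow[symmetric]) simp
      finally show ?thesis by (simp add: B_def)
    qed
    show "B 0 \<subseteq> algebra_center" using assms(5) by (simp add: B_def)
    show "x = 0" if "x + x = 0" for x :: 'a
    proof -
      have "scale 2 x = 0" using that by (metis one_add_one scale_left_distrib scale_one)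
      then show ?thesis by simp
    qed
  qed
  have "a \<in> span (\<Union>k. B k)" for a
  proof -
    have "A \<xi> \<subseteq> (\<Union>k. B k)" if "\<xi> \<in> carrier G" for \<xi>
    proof -
      obtain k :: nat where "\<xi> = g [^]\<^bsub>G\<^esub> k" using powers[OF \<open>\<xi> \<in> carrier G\<close>] by blast
      then show ?thesis by (auto simp: B_def)
    qed
    moreover obtain f where "\<forall>\<xi>\<in>carrier G. f \<xi> \<in> A \<xi>" "\<forall>\<xi>. \<xi> \<notin> carrier G \<longrightarrow> f \<xi> = 0"
      "a = (\<Sum>\<xi> | f \<xi> \<noteq> 0. f \<xi>)"
      using direct_sum[of a] by blast
    ultimately have "f \<xi> \<in> (\<Union>k. B k)" if "f \<xi> \<noteq> 0" for \<xi>
      using that by blast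
    then show ?thesis
      unfolding \<open>a = _\<close> by (intro span_sum span_base) simp
  qed
  then have "commutator_monomials UNIV \<subseteq> span (commutator_monomials (\<Union>k. B k))"
    using commutator_monomials_span by (metis UNIV_eq_I)
  then have "carries (commutator_monomials UNIV) (UNIV :: 'a set) {0}"
    using carries_span[OF homogeneous_commutators_nilpotent] by (rule carries_subset)
  from commutator_nilpotence_consequences[OF this] lie_algebra_commutator
  show ?thesis by blast
qed

end
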